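(* Let $k\ge 2$ be a constant and let $\Phi$ be a random $k$-SAT formula on $n$ variables with $m=\Theta(n)$ clauses whose variable distribution is given by weights following a power law with exponent $\beta$. Then there are $d_{\min}=\Theta(w_{\min})$ and $d_{\max}=\Theta(w_{\max})$ such that for all $d_{\min}\le d\le d_{\max}$, with high probability $N_{\geq d}=\Theta(n\cdot d^{1-\beta})$, where $N_{\ge d}$ is the number of variables that appear (negated or unnegated) in at least $d$ clauses of $\Phi$.
   Context: Random $k$-SAT model: given $n$ Boolean variables, $m$ clauses and a probability distribution $\vec p$ on $\{1,\dots,n\}$, the formula is the conjunction of $m$ independently sampled clauses; each clause is sampled by selecting $k$ variables independently from $\vec p$, repeating until no two coincide, and negating each independently with probability $1/2$. The distribution is given by weights $w_1\le\dots\le w_n$ via $p_i=w_i/\sum_j w_j$. The weights follow a power law with exponent $\beta$ if $w_1=\Theta(1)$, $w_n=\Theta(n^{1/(\beta-1)})$, and for all $w\in[w_1,w_n]$ the fraction of indices $i$ with $w_i\ge w$ is $\Theta(w^{1-\beta})$. Here $w_{\min}=w_1$, $w_{\max}=w_n$. Asymptotics as $n\to\infty$ with $k,\beta$ constant; "with high probability" means with probability $1-O(n^{-\delta})$ for some $\delta>0$.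
   Formalization: The power-law exponent is assumed to satisfy β > 2; for 1 < β ≤ 2 the claim is false, since with high probability no variable appears in d_max = Θ(w_max) clauses (w_max exceeds m for β < 2, and degrees are O(n/log n) for β = 2). *)

theory Defs
  imports "HOL-Probability.Probability" "HOL-Library.Landau_Symbols"
begin

text \<open>A literal is a variable together with its sign (\<^term>\<open>True\<close> for unnegated). A clause is the
  list of its literals, a formula the list of its clauses: a clause that is sampled repeatedly
  is counted repeatedly.\<close>

type_synonym literal = "nat \<times> bool"
type_synonym clause = "literal list"
type_synonym cnf = "clause list"

definition clause_vars :: "clause \<Rightarrow> nat set" where
  "clause_vars c = fst ` set c"

definition var_degree :: "cnf \<Rightarrow> nat \<Rightarrow> nat" where
  "var_degree \<Phi> v = card {j. j < length \<Phi> \<and> v \<in> clause_vars (\<Phi> ! j)}"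

definition num_vars_degree_ge :: "nat \<Rightarrow> cnf \<Rightarrow> real \<Rightarrow> nat" where
  "num_vars_degree_ge n \<Phi> d = card {v \<in> {1..n}. d \<le> real (var_degree \<Phi> v)}"

text \<open>Redrawing \<open>k\<close> independent variables until no two coincide yields the product distribution
  conditioned on distinctness, see \<open>distinct_vars_pmf_redraw\<close>. This is meaningful only if
  the support of \<open>p\<close> has at least \<open>k\<close> elements.\<close>

definition distinct_vars_pmf :: "nat \<Rightarrow> nat pmf \<Rightarrow> nat list pmf" where
  "distinct_vars_pmf k p = cond_pmf (replicate_pmf k p) {xs. distinct xs}"

definition random_clause :: "nat \<Rightarrow> nat pmf \<Rightarrow> clause pmf" where
  "random_clause k p =
     do {vs \<leftarrow> distinct_vars_pmf k p;
         ss \<leftarrow> replicate_pmf k (bernoulli_pmf (1 / 2));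
         return_pmf (zip vs ss)}"

definition random_ksat :: "nat \<Rightarrow> nat \<Rightarrow> nat pmf \<Rightarrow> cnf pmf" where
  "random_ksat k m p = replicate_pmf m (random_clause k p)"

definition weight_pmf :: "nat \<Rightarrow> (nat \<Rightarrow> real) \<Rightarrow> nat pmf" where
  "weight_pmf n w = embed_pmf (\<lambda>i. if i \<in> {1..n} then w i / (\<Sum>j=1..n. w j) else 0)"

text \<open>\<open>w n i\<close> is the weight of variable \<open>i\<close> among \<open>n\<close> variables. The constants in the third
  condition are uniform in \<open>x\<close>.\<close>

definition power_law_weights :: "real \<Rightarrow> (nat \<Rightarrow> nat \<Rightarrow> real) \<Rightarrow> bool" where
  "power_law_weights \<beta> w \<longleftrightarrow>
     (\<lambda>n. w n 1) \<in> \<Theta>(\<lambda>n. 1) \<and>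
     (\<lambda>n. w n n) \<in> \<Theta>(\<lambda>n. real n powr (1 / (\<beta> - 1))) \<and>
     (\<exists>a>0. \<exists>b>0. \<forall>\<^sub>F n in sequentially. \<forall>x\<in>{w n 1..w n n}.
        real (card {i \<in> {1..n}. x \<le> w n i}) / real n
          \<in> {a * x powr (1 - \<beta>)..b * x powr (1 - \<beta>)})"

lemma pmf_weight_pmf:
  assumes "n \<ge> 1" and "\<And>i. i \<in> {1..n} \<Longrightarrow> 0 < w i"
  shows "pmf (weight_pmf n w) i = (if i \<in> {1..n} then w i / (\<Sum>j=1..n. w j) else 0)"
  unfolding weight_pmf_def
proof (rule pmf_embed_pmf)
  have pos: "0 < (\<Sum>j=1..n. w j)"
    using assms by (intro sum_pos) auto
  show "0 \<le> (if i \<in> {1..n} then w i / (\<Sum>j=1..n. w j) else 0)" for i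
    using assms(2)[of i] pos by auto
  have "(\<integral>\<^sup>+ i. ennreal (if i \<in> {1..n} then w i / (\<Sum>j=1..n. w j) else 0) \<partial>count_space UNIV)
      = (\<Sum>i\<in>{1..n}. ennreal (if i \<in> {1..n} then w i / (\<Sum>j=1..n. w j) else 0))"
    by (rule nn_integral_count_space'[where A = "{1..n}"]) auto
  also have "\<dots> = (\<Sum>i\<in>{1..n}. ennreal (w i / (\<Sum>j=1..n. w j)))"
    by (intro sum.cong) auto
  also have "\<dots> = ennreal (\<Sum>i\<in>{1..n}. w i / (\<Sum>j=1..n. w j))"
    using assms(2) pos by (intro sum_ennreal) (auto intro!: divide_nonneg_pos less_imp_le)
  also have "(\<Sum>i\<in>{1..n}. w i / (\<Sum>j=1..n. w j)) = 1"
    using pos by (simp flip: sum_divide_distrib)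
  finally show "(\<integral>\<^sup>+ i. ennreal (if i \<in> {1..n} then w i / (\<Sum>j=1..n. w j) else 0) \<partial>count_space UNIV) = 1"
    by simp
qed

lemma cond_pmf_redraw:
  assumes ne: "set_pmf p \<inter> A \<noteq> {}"
  shows "cond_pmf p A = do {x \<leftarrow> p; if x \<in> A then return_pmf x else cond_pmf p A}"
proof (rule pmf_eqI)
  fix y
  let ?q = "measure p A"
  have q: "?q > 0"
    using ne by (auto simp: zero_less_measure_iff measure_pmf_zero_iff)
  have "pmf (do {x \<leftarrow> p; if x \<in> A then return_pmf x else cond_pmf p A}) y
      = (\<integral>x. indicator ({y} \<inter> A) x + pmf (cond_pmf p A) y * indicator (- A) x \<partial>p)"
    unfolding pmf_bind by (intro Bochner_Integration.integral_cong) (auto simp: indicator_def)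
  also have "\<dots> = measure p ({y} \<inter> A) + pmf (cond_pmf p A) y * measure p (- A)"
    by (subst Bochner_Integration.integral_add) (auto simp: measure_pmf.emeasure_eq_measure)
  also have "measure p (- A) = 1 - ?q"
    using measure_pmf.prob_compl[of A p] by (simp add: Compl_eq_Diff_UNIV)
  also have "measure p ({y} \<inter> A) = pmf (cond_pmf p A) y * ?q"
    using q by (auto simp: pmf_cond[OF ne] measure_pmf_single)
  also have "pmf (cond_pmf p A) y * ?q + pmf (cond_pmf p A) y * (1 - ?q) = pmf (cond_pmf p A) y"
    by (simp add: algebra_simps)
  finally show "pmf (cond_pmf p A) y =
      pmf (do {x \<leftarrow> p; if x \<in> A then return_pmf x else cond_pmf p A}) y" by simp
qed

lemma distinct_vars_pmf_redraw:
  assumes "set_pmf (replicate_pmf k p) \<inter> {xs. distinct xs} \<noteq> {}"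
  shows "distinct_vars_pmf k p =
    do {xs \<leftarrow> replicate_pmf k p; if distinct xs then return_pmf xs else distinct_vars_pmf k p}"
  using cond_pmf_redraw[OF assms] unfolding distinct_vars_pmf_def by simp

end

theory Submission
  imports Defs "HOL-Real_Asymp.Real_Asymp"
begin

text \<open>As \<open>\<beta> > 2\<close>, the total weight is \<open>\<Theta>(n)\<close> and the largest variable probability tends to \<open>0\<close>, so
  conditioning a clause on distinct variables distorts probabilities only by a constant factor and
  the degree of variable \<open>i\<close> is binomial with mean \<open>\<Theta>(w i)\<close>. By Chernoff, a variable whose weight
  is a large multiple of \<open>d\<close> has degree at least \<open>d\<close>, and one whose weight is a small multiple
  of \<open>d\<close> has a smaller degree, each up to an error probability \<open>exp (- d / 2)\<close>. For \<open>d\<close> at least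
  a small power of \<open>n\<close> a union bound over all variables suffices. For smaller \<open>d\<close> the Chernoff
  bounds only give the expectation of \<open>N\<^bsub>\<ge>d\<^esub>\<close> up to constants; resampling one clause changes
  \<open>N\<^bsub>\<ge>d\<^esub>\<close> by at most \<open>k\<close>, so its variance is \<open>O(n)\<close>, and Chebyshev's inequality applies because
  \<open>n * d powr (1 - \<beta>)\<close> is then much larger than the square root of \<open>n\<close>.\<close>

section \<open>Independent samples\<close>

lemma finite_set_replicate_pmf:
  assumes "finite (set_pmf p)"
  shows "finite (set_pmf (replicate_pmf n p))"
  using finite_lists_length_eq[OF assms, of n]
  by (rule rev_finite_subset) (auto simp: set_replicate_pmf)

text \<open>Conditioning on the first sample; the inductions over the number of samples below rest
  on this. Finite support settles all integrability questions.\<close>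

lemma expectation_replicate_pmf_Suc:
  fixes f :: "'a list \<Rightarrow> real"
  assumes "finite (set_pmf p)"
  shows "measure_pmf.expectation (replicate_pmf (Suc n) p) f =
    measure_pmf.expectation p (\<lambda>x. measure_pmf.expectation (replicate_pmf n p) (\<lambda>xs. f (x # xs)))"
proof -
  have eq: "replicate_pmf (Suc n) p = p \<bind> (\<lambda>x. map_pmf ((#) x) (replicate_pmf n p))"
    by (simp add: map_pmf_def)
  have "measure_pmf.expectation (replicate_pmf (Suc n) p) f =
    (\<Sum>x\<in>set_pmf p. pmf p x *\<^sub>R measure_pmf.expectation (map_pmf ((#) x) (replicate_pmf n p)) f)"
    unfolding eq using assms finite_set_replicate_pmf[OF assms]
    by (intro pmf_expectation_bind) auto
  also have "\<dots> = measure_pmf.expectation p (\<lambda>x. measure_pmf.expectation (replicate_pmf n p) (\<lambda>xs. f (x # xs)))"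
    using assms by (subst integral_measure_pmf_real[of "set_pmf p"]) (auto simp: mult.commute)
  finally show ?thesis .
qed

lemma prob_replicate_pmf_Suc:
  assumes "finite (set_pmf p)"
  shows "measure_pmf.prob (replicate_pmf (Suc n) p) A =
    measure_pmf.expectation p (\<lambda>x. measure_pmf.prob (replicate_pmf n p) {xs. x # xs \<in> A})"
proof -
  have ind: "(\<lambda>xs. indicator A (x # xs) :: real) = indicator {xs. x # xs \<in> A}" for x
    by (auto simp: indicator_def fun_eq_iff)
  have "measure_pmf.prob (replicate_pmf (Suc n) p) A
      = measure_pmf.expectation (replicate_pmf (Suc n) p) (indicator A)"
    by simp
  also have "\<dots> = measure_pmf.expectation p (\<lambda>x. measure_pmf.expectation (replicate_pmf n p)
      (indicator {xs. x # xs \<in> A}))"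
    unfolding expectation_replicate_pmf_Suc[OF assms] ind ..
  finally show ?thesis by simp
qed

lemma expectation_mono_pmf:
  fixes f g :: "'a \<Rightarrow> real"
  assumes "finite (set_pmf p)" "\<And>x. x \<in> set_pmf p \<Longrightarrow> f x \<le> g x"
  shows "measure_pmf.expectation p f \<le> measure_pmf.expectation p g"
  using assms by (intro integral_mono_AE integrable_measure_pmf_finite) (auto simp: AE_measure_pmf_iff)

lemma prob_le_expectation_pmf:
  fixes f :: "'a \<Rightarrow> real"
  assumes "finite (set_pmf p)" "\<And>x. x \<in> A \<Longrightarrow> 1 \<le> f x" "\<And>x. 0 \<le> f x"
  shows "measure_pmf.prob p A \<le> measure_pmf.expectation p f"
proof -
  have "measure_pmf.prob p A = measure_pmf.expectation p (indicator A)"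
    by simp
  also have "\<dots> \<le> measure_pmf.expectation p f"
    using assms by (intro expectation_mono_pmf) (auto simp: indicator_def)
  finally show ?thesis .
qed

lemma prob_le_sum_pmf:
  assumes "finite S" "\<And>x. pmf p x \<le> r"
  shows "measure_pmf.prob p S \<le> real (card S) * r"
  using assms sum_bounded_above[of S "pmf p" r] by (simp add: measure_measure_pmf_finite)

text \<open>A union bound over collisions. The forbidden set \<open>S\<close> is there for the
  induction: once \<open>x\<close> has been drawn first, the remaining samples must also avoid
  \<open>x\<close>.\<close>

lemma prob_replicate_pmf_distinct_avoid:
  assumes fin: "finite (set_pmf p)" and r: "\<And>x. pmf p x \<le> r" and "finite S"
  shows "1 - real k * real (k + card S) * r
    \<le> measure_pmf.prob (replicate_pmf k p) {xs. distinct xs \<and> set xs \<inter> S = {}}"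
  using \<open>finite S\<close>
proof (induction k arbitrary: S)
  case 0
  then show ?case by simp
next
  case (Suc k)
  have r0: "0 \<le> r" using r[of undefined] pmf_nonneg[of p undefined] by linarith
  \<comment> \<open>\<open>?g\<close> is the induction hypothesis for \<open>insert x S\<close>. A
    first sample inside \<open>S\<close> is charged a full unit, which makes the lower bound
    nonpositive there; on average this costs at most \<open>card S * r\<close>.\<close>
  let ?g = "1 - real k * real (k + Suc (card S)) * r"
  have "?g - real (card S) * r \<le> ?g - measure_pmf.prob p S"
    using prob_le_sum_pmf[OF Suc.prems, of p r] r by simp
  also have "\<dots> = measure_pmf.expectation p (\<lambda>x. ?g - indicator S x)"
    by (subst Bochner_Integration.integral_diff) (auto intro: integrable_measure_pmf_finite fin)
  also have "\<dots> \<le> measure_pmf.expectation p (\<lambda>x. measure_pmf.prob (replicate_pmf k p)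
       {xs. x # xs \<in> {xs. distinct xs \<and> set xs \<inter> S = {}}})"
  proof (rule expectation_mono_pmf[OF fin])
    fix x
    show "?g - indicator S x \<le> measure_pmf.prob (replicate_pmf k p)
       {xs. x # xs \<in> {xs. distinct xs \<and> set xs \<inter> S = {}}}"
    proof (cases "x \<in> S")
      case True
      have "0 \<le> real k * real (k + Suc (card S)) * r" using r0 by simp
      with True show ?thesis by simp
    next
      case False
      have "{xs. x # xs \<in> {xs. distinct xs \<and> set xs \<inter> S = {}}}
          = {xs. distinct xs \<and> set xs \<inter> insert x S = {}}"
        using False by auto
      then show ?thesis
        using Suc.IH[of "insert x S"] False Suc.prems by simp
    qed
  qed
  also have "\<dots> = measure_pmf.prob (replicate_pmf (Suc k) p) {xs. distinct xs \<and> set xs \<inter> S = {}}"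
    by (rule prob_replicate_pmf_Suc[OF fin, symmetric])
  finally have 1: "?g - real (card S) * r \<le> \<dots>" .
  have "0 \<le> (real k + 1) * r" using r0 by simp
  then have "1 - real (Suc k) * real (Suc k + card S) * r \<le> ?g - real (card S) * r"
    by (simp add: algebra_simps)
  with 1 show ?case by linarith
qed

lemma prob_replicate_pmf_member_le:
  assumes fin: "finite (set_pmf p)"
  shows "measure_pmf.prob (replicate_pmf k p) {xs. v \<in> set xs} \<le> real k * pmf p v"
proof (induction k)
  case 0
  then show ?case by simp
next
  case (Suc k)
  have "measure_pmf.prob (replicate_pmf (Suc k) p) {xs. v \<in> set xs} =
     measure_pmf.expectation p (\<lambda>x. measure_pmf.prob (replicate_pmf k p) {xs. x # xs \<in> {xs. v \<in> set xs}})"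
    by (rule prob_replicate_pmf_Suc[OF fin])
  also have "\<dots> \<le> measure_pmf.expectation p (\<lambda>x. indicator {v} x + real k * pmf p v)"
    using Suc by (intro expectation_mono_pmf[OF fin]) (auto simp: indicator_def)
  also have "\<dots> = pmf p v + real k * pmf p v"
    by (subst Bochner_Integration.integral_add)
      (auto intro: integrable_measure_pmf_finite fin simp: measure_pmf_single)
  finally show ?case by (simp add: algebra_simps)
qed

text \<open>It suffices to count outcomes with \<open>v\<close> in the first position and with the
  other entries distinct and different from \<open>v\<close>.\<close>

lemma prob_replicate_pmf_member_distinct_ge:
  assumes fin: "finite (set_pmf p)" and r: "\<And>x. pmf p x \<le> r"
  shows "pmf p v * (1 - real k * real (k + 1) * r)
    \<le> measure_pmf.prob (replicate_pmf (Suc k) p) {xs. v \<in> set xs \<and> distinct xs}"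
proof -
  let ?g = "1 - real k * real (k + 1) * r"
  have "pmf p v * ?g = measure_pmf.expectation p (\<lambda>x. indicator {v} x * ?g)"
    by (simp add: measure_pmf_single)
  also have "\<dots> \<le> measure_pmf.expectation p (\<lambda>x. measure_pmf.prob (replicate_pmf k p)
       {xs. x # xs \<in> {xs. v \<in> set xs \<and> distinct xs}})"
  proof (rule expectation_mono_pmf[OF fin])
    fix x
    have "{xs. v # xs \<in> {xs. v \<in> set xs \<and> distinct xs}} = {xs. distinct xs \<and> set xs \<inter> {v} = {}}"
      by auto
    then show "indicator {v} x * ?g \<le> measure_pmf.prob (replicate_pmf k p)
       {xs. x # xs \<in> {xs. v \<in> set xs \<and> distinct xs}}"
      using prob_replicate_pmf_distinct_avoid[OF fin r, of "{v}" k] by (cases "x = v") auto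
  qed
  also have "\<dots> = measure_pmf.prob (replicate_pmf (Suc k) p) {xs. v \<in> set xs \<and> distinct xs}"
    by (rule prob_replicate_pmf_Suc[OF fin, symmetric])
  finally show ?thesis .
qed

section \<open>Variance of functions of independent samples\<close>

lemma expectation_square_le:
  fixes g :: "'a \<Rightarrow> real"
  assumes fin: "finite (set_pmf p)"
    and c: "\<And>x y. x \<in> set_pmf p \<Longrightarrow> y \<in> set_pmf p \<Longrightarrow> \<bar>g x - g y\<bar> \<le> c"
  shows "measure_pmf.expectation p (\<lambda>x. (g x)\<^sup>2) \<le> (measure_pmf.expectation p g)\<^sup>2 + c\<^sup>2"
proof -
  let ?E = "measure_pmf.expectation p"
  have int: "integrable p f" for f :: "'a \<Rightarrow> real"
    by (rule integrable_measure_pmf_finite[OF fin])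
  \<comment> \<open>The mean is an average of values that lie within \<open>c\<close> of
    \<open>g x\<close>.\<close>
  have dev: "\<bar>g x - ?E g\<bar> \<le> c" if x: "x \<in> set_pmf p" for x
  proof -
    have "?E g \<le> ?E (\<lambda>_. g x + c)" "?E (\<lambda>_. g x - c) \<le> ?E g"
      using c[OF x] by (intro expectation_mono_pmf[OF fin]; force simp: abs_le_iff)+
    then show ?thesis by simp
  qed
  have "?E (\<lambda>x. (g x)\<^sup>2) - (?E g)\<^sup>2 = measure_pmf.variance p g"
    by (rule measure_pmf.variance_eq[symmetric]) (rule int)+
  also have "\<dots> \<le> ?E (\<lambda>_. c\<^sup>2)"
    using dev by (intro expectation_mono_pmf[OF fin]) (metis abs_ge_zero power2_abs power_mono)
  finally show ?thesis by simp
qed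

text \<open>A weak form of the Efron--Stein inequality, by conditioning on the first coordinate.\<close>

lemma expectation_square_replicate_pmf_le:
  fixes f :: "'a list \<Rightarrow> real"
  assumes fin: "finite (set_pmf p)"
    and c: "\<And>xs x y ys. x \<in> set_pmf p \<Longrightarrow> y \<in> set_pmf p \<Longrightarrow>
      \<bar>f (xs @ x # ys) - f (xs @ y # ys)\<bar> \<le> c"
  shows "measure_pmf.expectation (replicate_pmf n p) (\<lambda>xs. (f xs)\<^sup>2)
    \<le> (measure_pmf.expectation (replicate_pmf n p) f)\<^sup>2 + real n * c\<^sup>2"
  using c
proof (induction n arbitrary: f)
  case 0
  then show ?case by simp
next
  case (Suc n)
  let ?E = "measure_pmf.expectation p" and ?R = "measure_pmf.expectation (replicate_pmf n p)"
  \<comment> \<open>The conditional mean given the first sample. The induction hypothesis treats the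
    other samples for each fixed first one; \<open>g\<close> inherits the oscillation bound
    \<open>c\<close> by averaging, which accounts for one more \<open>c\<close> squared.\<close>
  define g where "g x = ?R (\<lambda>xs. f (x # xs))" for x
  have "measure_pmf.expectation (replicate_pmf (Suc n) p) (\<lambda>xs. (f xs)\<^sup>2)
      = ?E (\<lambda>x. ?R (\<lambda>xs. (f (x # xs))\<^sup>2))"
    by (rule expectation_replicate_pmf_Suc[OF fin])
  also have "\<dots> \<le> ?E (\<lambda>x. (g x)\<^sup>2 + real n * c\<^sup>2)"
    unfolding g_def
  proof (intro expectation_mono_pmf[OF fin] Suc.IH)
    fix z xs x y ys
    assume "x \<in> set_pmf p" "y \<in> set_pmf p"
    from Suc.prems[OF this, of "z # xs" ys]
    show "\<bar>f (z # xs @ x # ys) - f (z # xs @ y # ys)\<bar> \<le> c" by simp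
  qed
  also have "\<dots> = ?E (\<lambda>x. (g x)\<^sup>2) + real n * c\<^sup>2"
    by (subst Bochner_Integration.integral_add) (auto intro: integrable_measure_pmf_finite fin)
  also have "\<dots> \<le> ((?E g)\<^sup>2 + c\<^sup>2) + real n * c\<^sup>2"
  proof (intro add_right_mono expectation_square_le[OF fin])
    fix x y assume xy: "x \<in> set_pmf p" "y \<in> set_pmf p"
    have int: "integrable (replicate_pmf n p) h" for h :: "'a list \<Rightarrow> real"
      by (intro integrable_measure_pmf_finite finite_set_replicate_pmf fin)
    have "\<bar>g x - g y\<bar> = \<bar>?R (\<lambda>xs. f (x # xs) - f (y # xs))\<bar>"
      unfolding g_def by (simp add: int)
    also have "\<dots> \<le> ?R (\<lambda>xs. \<bar>f (x # xs) - f (y # xs)\<bar>)"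
      by (rule integral_abs_bound)
    also have "\<dots> \<le> ?R (\<lambda>_. c)"
      using Suc.prems[OF xy, of "[]"]
      by (intro expectation_mono_pmf finite_set_replicate_pmf fin) simp
    finally show "\<bar>g x - g y\<bar> \<le> c" by simp
  qed
  also have "?E g = measure_pmf.expectation (replicate_pmf (Suc n) p) f"
    unfolding g_def by (rule expectation_replicate_pmf_Suc[OF fin, symmetric])
  finally show ?case by (simp add: algebra_simps)
qed

lemma prob_replicate_pmf_deviation_le:
  fixes f :: "'a list \<Rightarrow> real"
  assumes fin: "finite (set_pmf p)"
    and c: "\<And>xs x y ys. x \<in> set_pmf p \<Longrightarrow> y \<in> set_pmf p \<Longrightarrow>
      \<bar>f (xs @ x # ys) - f (xs @ y # ys)\<bar> \<le> c"
    and t: "t > 0"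
  shows "measure_pmf.prob (replicate_pmf n p)
      {xs. t \<le> \<bar>f xs - measure_pmf.expectation (replicate_pmf n p) f\<bar>} \<le> real n * c\<^sup>2 / t\<^sup>2"
proof -
  have int: "integrable (replicate_pmf n p) h" for h :: "'a list \<Rightarrow> real"
    by (intro integrable_measure_pmf_finite finite_set_replicate_pmf fin)
  have "measure_pmf.prob (replicate_pmf n p)
      {xs. t \<le> \<bar>f xs - measure_pmf.expectation (replicate_pmf n p) f\<bar>}
    \<le> measure_pmf.variance (replicate_pmf n p) f / t\<^sup>2"
    using measure_pmf.Chebyshev_inequality[of f "replicate_pmf n p" t] int t by simp
  also have "measure_pmf.variance (replicate_pmf n p) f
      = measure_pmf.expectation (replicate_pmf n p) (\<lambda>xs. (f xs)\<^sup>2)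
        - (measure_pmf.expectation (replicate_pmf n p) f)\<^sup>2"
    by (rule measure_pmf.variance_eq) (rule int)+
  also have "\<dots> / t\<^sup>2 \<le> real n * c\<^sup>2 / t\<^sup>2"
    using expectation_square_replicate_pmf_le[where f = f, OF fin c, of n]
    by (intro divide_right_mono) auto
  finally show ?thesis .
qed

text \<open>Independence in the form that the Chernoff bounds use: the moment generating function of
  a degree factorises over the clauses.\<close>

lemma expectation_replicate_pmf_prod_list:
  fixes h :: "'a \<Rightarrow> real"
  assumes fin: "finite (set_pmf p)"
  shows "measure_pmf.expectation (replicate_pmf n p) (\<lambda>xs. prod_list (map h xs))
    = (measure_pmf.expectation p h) ^ n"
proof (induction n)
  case 0
  then show ?case by simp
next
  case (Suc n)
  then show ?case
    by (subst expectation_replicate_pmf_Suc[OF fin]) (simp add: mult.commute)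
qed

section \<open>Degrees in random formulas\<close>

lemma measure_cond_pmf:
  assumes "set_pmf p \<inter> A \<noteq> {}"
  shows "measure_pmf.prob (cond_pmf p A) B = measure_pmf.prob p (A \<inter> B) / measure_pmf.prob p A"
proof -
  have "emeasure (measure_pmf p) A \<noteq> 0"
    using assms by (auto simp: measure_pmf.emeasure_eq_measure measure_pmf_zero_iff)
  then show ?thesis
    using assms by (simp add: cond_pmf.rep_eq measure_uniform_measure measure_pmf.emeasure_eq_measure)
qed

section \<open>Random clauses when every variable has small probability\<close>

context
  fixes p :: "nat pmf" and r :: real and k :: nat
  assumes fin: "finite (set_pmf p)"
    and r: "\<And>x. pmf p x \<le> r"
    and k: "k \<ge> 1"
    and kr: "2 * (real k)\<^sup>2 * r \<le> 1"
begin

text \<open>The assumption \<open>kr\<close> keeps the collision bound \<open>k * k * r\<close>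
  below one half, so that conditioning on distinctness at most doubles a probability.\<close>

lemma prob_distinct_ge_half: "1 / 2 \<le> measure_pmf.prob (replicate_pmf k p) {xs. distinct xs}"
  using prob_replicate_pmf_distinct_avoid[OF fin r, of "{}" k] kr by (simp add: power2_eq_square)

lemma distinct_support_nonempty: "set_pmf (replicate_pmf k p) \<inter> {xs. distinct xs} \<noteq> {}"
proof
  assume "set_pmf (replicate_pmf k p) \<inter> {xs. distinct xs} = {}"
  then have "measure_pmf.prob (replicate_pmf k p) {xs. distinct xs} = 0"
    by (simp add: measure_pmf_zero_iff)
  then show False using prob_distinct_ge_half by simp
qed

lemma set_distinct_vars_pmf:
  "set_pmf (distinct_vars_pmf k p) = set_pmf (replicate_pmf k p) \<inter> {xs. distinct xs}"
  unfolding distinct_vars_pmf_def by (rule set_cond_pmf[OF distinct_support_nonempty])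

lemma finite_set_random_clause: "finite (set_pmf (random_clause k p))"
  unfolding random_clause_def
  by (auto simp: set_distinct_vars_pmf finite_set_replicate_pmf fin)

lemma card_clause_vars_random_clause:
  assumes "c \<in> set_pmf (random_clause k p)"
  shows "card (clause_vars c) \<le> k"
proof -
  have "length c = k"
    using assms by (auto simp: random_clause_def set_distinct_vars_pmf set_replicate_pmf)
  then have "card (set c) \<le> k"
    using card_length[of c] by simp
  then show ?thesis
    unfolding clause_vars_def using card_image_le[of "set c" fst] by simp
qed

text \<open>The sign list has the same length as the variable list, so \<open>zip\<close> drops no
  variable and projecting to first components removes the signs again.\<close>

lemma map_clause_vars_random_clause:
  "map_pmf clause_vars (random_clause k p) = map_pmf set (distinct_vars_pmf k p)"
proof -
  have "map_pmf clause_vars (random_clause k p) = distinct_vars_pmf k p \<bind>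
      (\<lambda>vs. replicate_pmf k (bernoulli_pmf (1 / 2)) \<bind> (\<lambda>ss. return_pmf (clause_vars (zip vs ss))))"
    by (simp add: random_clause_def map_bind_pmf)
  also have "\<dots> = distinct_vars_pmf k p \<bind>
      (\<lambda>vs. replicate_pmf k (bernoulli_pmf (1 / 2 :: real)) \<bind> (\<lambda>ss. return_pmf (set vs)))"
  proof (intro bind_pmf_cong refl arg_cong[of _ _ return_pmf])
    fix vs ss
    assume "vs \<in> set_pmf (distinct_vars_pmf k p)"
      and "ss \<in> set_pmf (replicate_pmf k (bernoulli_pmf (1 / 2 :: real)))"
    then have "length vs = length ss"
      unfolding set_distinct_vars_pmf set_replicate_pmf by simp
    then show "clause_vars (zip vs ss) = set vs"
      unfolding clause_vars_def by (metis map_fst_zip set_map)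
  qed
  finally show ?thesis by (simp add: map_pmf_def)
qed

text \<open>The probability is a quotient whose denominator lies between one half and 1. For the
  lower bound, dividing can only increase the numerator; for the upper bound, a union bound over the
  \<open>k\<close> positions is at most doubled.\<close>

lemma prob_random_clause_member:
  "measure_pmf.prob (random_clause k p) {c. v \<in> clause_vars c} \<in> {pmf p v / 2..2 * real k * pmf p v}"
proof -
  let ?R = "replicate_pmf k p"
  have "measure_pmf.prob (random_clause k p) {c. v \<in> clause_vars c}
      = measure_pmf.prob (map_pmf clause_vars (random_clause k p)) {V. v \<in> V}"
    by (simp add: measure_map_pmf vimage_def)
  also have "\<dots> = measure_pmf.prob (distinct_vars_pmf k p) {xs. v \<in> set xs}"
    unfolding map_clause_vars_random_clause by (simp add: measure_map_pmf vimage_def)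
  also have "\<dots> = measure_pmf.prob ?R {xs. v \<in> set xs \<and> distinct xs}
      / measure_pmf.prob ?R {xs. distinct xs}"
    unfolding distinct_vars_pmf_def measure_cond_pmf[OF distinct_support_nonempty]
    by (simp add: Int_def conj_commute)
  finally have eq: "measure_pmf.prob (random_clause k p) {c. v \<in> clause_vars c}
      = measure_pmf.prob ?R {xs. v \<in> set xs \<and> distinct xs} / measure_pmf.prob ?R {xs. distinct xs}"
    (is "?q = ?a / ?b") .
  have b: "1 / 2 \<le> ?b" "?b \<le> 1" using prob_distinct_ge_half by auto
  have r0: "0 \<le> r" using r[of v] pmf_nonneg[of p v] by linarith
  obtain j where j: "k = Suc j" using k by (cases k) auto
  have "real j * real (j + 1) * r \<le> (real k)\<^sup>2 * r"
    unfolding j power2_eq_square using r0 by (intro mult_right_mono mult_mono) auto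
  then have "pmf p v * (1 / 2) \<le> pmf p v * (1 - real j * real (j + 1) * r)"
    using kr by (intro mult_left_mono) auto
  also have "\<dots> \<le> ?a"
    using prob_replicate_pmf_member_distinct_ge[OF fin r, of v j] j by simp
  also have "\<dots> \<le> ?a / ?b"
    using b by (simp add: le_divide_eq mult_left_le)
  finally have 1: "pmf p v / 2 \<le> ?q" using eq by simp
  have "?a \<le> measure_pmf.prob ?R {xs. v \<in> set xs}"
    by (intro measure_pmf.finite_measure_mono) auto
  also have "\<dots> \<le> real k * pmf p v"
    by (rule prob_replicate_pmf_member_le[OF fin])
  also have "\<dots> \<le> 2 * real k * pmf p v * ?b"
    using mult_left_mono[OF b(1), of "2 * real k * pmf p v"] by simp
  finally have "?a / ?b \<le> 2 * real k * pmf p v"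
    using b by (simp add: divide_le_eq)
  with 1 eq show ?thesis by simp
qed

end

section \<open>Degrees as sums of independent contributions of clauses\<close>

lemma var_degree_eq_length_filter:
  "var_degree \<Phi> v = length (filter (\<lambda>c. v \<in> clause_vars c) \<Phi>)"
  unfolding var_degree_def by (simp add: length_filter_conv_card)

lemma exp_var_degree:
  "exp (t * real (var_degree \<Phi> v)) = prod_list (map (\<lambda>c. if v \<in> clause_vars c then exp t else 1) \<Phi>)"
  unfolding var_degree_eq_length_filter
  by (induction \<Phi>) (simp_all add: distrib_left exp_add)

text \<open>When \<open>x\<close> takes the place of \<open>y\<close>, only a variable occurring in
  \<open>x\<close> can newly reach the threshold. Exchanging the roles of \<open>x\<close> and
  \<open>y\<close> gives the two-sided bounded difference.\<close>

lemma num_vars_degree_ge_replace_clause: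
  "num_vars_degree_ge n (xs @ x # ys) d \<le> num_vars_degree_ge n (xs @ y # ys) d + card (clause_vars x)"
proof -
  let ?A = "\<lambda>z. {v \<in> {1..n}. d \<le> real (var_degree (xs @ z # ys) v)}"
  have "?A x \<subseteq> ?A y \<union> clause_vars x"
    by (auto simp: var_degree_eq_length_filter split: if_splits)
  then have "card (?A x) \<le> card (?A y \<union> clause_vars x)"
    by (intro card_mono) (auto simp: clause_vars_def)
  also have "\<dots> \<le> card (?A y) + card (clause_vars x)"
    by (rule card_Un_le)
  finally show ?thesis unfolding num_vars_degree_ge_def .
qed

context
  fixes D :: "clause pmf" and m :: nat
  assumes finD: "finite (set_pmf D)"
begin

text \<open>One clause contributes the factor \<open>1 + (exp t - 1) * q\<close>, which is at most
  \<open>exp ((exp t - 1) * q)\<close>. The sign of \<open>t\<close> is left open so that the bound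
  serves both tails.\<close>

lemma expectation_exp_var_degree_le:
  "measure_pmf.expectation (replicate_pmf m D) (\<lambda>\<Phi>. exp (t * real (var_degree \<Phi> v)))
    \<le> exp (real m * measure_pmf.prob D {c. v \<in> clause_vars c} * (exp t - 1))"
proof -
  let ?q = "measure_pmf.prob D {c. v \<in> clause_vars c}"
  let ?h = "\<lambda>c. if v \<in> clause_vars c then exp t else 1"
  have "measure_pmf.expectation D ?h =
      measure_pmf.expectation D (\<lambda>c. 1 + (exp t - 1) * indicator {c. v \<in> clause_vars c} c)"
    by (intro Bochner_Integration.integral_cong) auto
  also have "\<dots> = 1 + (exp t - 1) * ?q"
    by (subst Bochner_Integration.integral_add) (auto intro: integrable_measure_pmf_finite finD)
  finally have h: "measure_pmf.expectation D ?h = 1 + (exp t - 1) * ?q" .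
  have "0 \<le> measure_pmf.expectation D ?h"
    by (intro integral_nonneg_AE) auto
  then have "(measure_pmf.expectation D ?h) ^ m \<le> exp ((exp t - 1) * ?q) ^ m"
    unfolding h by (intro power_mono exp_ge_add_one_self)
  then show ?thesis
    unfolding exp_var_degree expectation_replicate_pmf_prod_list[OF finD]
    by (simp add: mult_ac flip: exp_of_nat_mult)
qed

text \<open>Markov's inequality at \<open>t = 1\<close>: as \<open>exp 1 - 1\<close> is at most 2, a
  mean of at most \<open>d / 4\<close> uses up only half of the gain
  \<open>exp (- d)\<close>.\<close>

lemma prob_var_degree_ge_le:
  assumes "real m * measure_pmf.prob D {c. v \<in> clause_vars c} \<le> d / 4"
  shows "measure_pmf.prob (replicate_pmf m D) {\<Phi>. d \<le> real (var_degree \<Phi> v)} \<le> exp (- d / 2)"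
proof -
  let ?q = "measure_pmf.prob D {c. v \<in> clause_vars c}"
  let ?E = "measure_pmf.expectation (replicate_pmf m D)"
  have "measure_pmf.prob (replicate_pmf m D) {\<Phi>. d \<le> real (var_degree \<Phi> v)}
      \<le> ?E (\<lambda>\<Phi>. exp (- d) * exp (1 * real (var_degree \<Phi> v)))"
    by (intro prob_le_expectation_pmf finite_set_replicate_pmf finD) (simp_all flip: exp_add)
  also have "\<dots> = exp (- d) * ?E (\<lambda>\<Phi>. exp (1 * real (var_degree \<Phi> v)))"
    by (rule integral_mult_right_zero)
  also have "\<dots> \<le> exp (- d) * exp (real m * ?q * (exp 1 - 1))"
    by (intro mult_left_mono expectation_exp_var_degree_le) simp
  also have "\<dots> = exp (- d + real m * ?q * (exp 1 - 1))"
    by (rule exp_add[symmetric])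
  also have "\<dots> \<le> exp (- d / 2)"
  proof -
    have "real m * ?q * (exp 1 - 1) \<le> real m * ?q * 2"
      using exp_le by (intro mult_left_mono) auto
    then show ?thesis using assms by simp
  qed
  finally show ?thesis .
qed

text \<open>Markov's inequality at \<open>t = - 1\<close>: as \<open>exp (- 1) - 1\<close> is at
  most \<open>- 1 / 2\<close>, a mean of at least \<open>4 * d\<close> turns the loss
  \<open>exp d\<close> into \<open>exp (- d)\<close>.\<close>

lemma prob_var_degree_less_le:
  assumes "4 * d \<le> real m * measure_pmf.prob D {c. v \<in> clause_vars c}"
  shows "measure_pmf.prob (replicate_pmf m D) {\<Phi>. real (var_degree \<Phi> v) < d} \<le> exp (- d)"
proof -
  let ?q = "measure_pmf.prob D {c. v \<in> clause_vars c}"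
  let ?E = "measure_pmf.expectation (replicate_pmf m D)"
  have "measure_pmf.prob (replicate_pmf m D) {\<Phi>. real (var_degree \<Phi> v) < d}
      \<le> ?E (\<lambda>\<Phi>. exp d * exp (- 1 * real (var_degree \<Phi> v)))"
    by (intro prob_le_expectation_pmf finite_set_replicate_pmf finD) (simp_all flip: exp_add)
  also have "\<dots> = exp d * ?E (\<lambda>\<Phi>. exp (- 1 * real (var_degree \<Phi> v)))"
    by (rule integral_mult_right_zero)
  also have "\<dots> \<le> exp d * exp (real m * ?q * (exp (- 1) - 1))"
    by (intro mult_left_mono expectation_exp_var_degree_le) simp
  also have "\<dots> = exp (d + real m * ?q * (exp (- 1) - 1))"
    by (rule exp_add[symmetric])
  also have "\<dots> \<le> exp (- d)"
  proof -
    have "(2::real) \<le> exp 1"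
      using exp_ge_add_one_self[of "1::real"] by simp
    then have "exp (- 1 :: real) \<le> 1 / 2"
      by (simp add: exp_minus field_simps)
    then have "real m * ?q * (exp (- 1) - 1) \<le> real m * ?q * (- (1 / 2))"
      by (intro mult_left_mono) auto
    then show ?thesis using assms by simp
  qed
  finally show ?thesis .
qed

lemma expectation_num_vars_degree_ge:
  "measure_pmf.expectation (replicate_pmf m D) (\<lambda>\<Phi>. real (num_vars_degree_ge n \<Phi> d))
    = (\<Sum>v=1..n. measure_pmf.prob (replicate_pmf m D) {\<Phi>. d \<le> real (var_degree \<Phi> v)})"
proof -
  let ?E = "measure_pmf.expectation (replicate_pmf m D)"
  have "real (num_vars_degree_ge n \<Phi> d)
      = (\<Sum>v=1..n. indicator {\<Phi>. d \<le> real (var_degree \<Phi> v)} \<Phi>)" for \<Phi>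
    unfolding num_vars_degree_ge_def by (simp add: indicator_def sum.If_cases Int_def)
  then have "?E (\<lambda>\<Phi>. real (num_vars_degree_ge n \<Phi> d))
      = ?E (\<lambda>\<Phi>. \<Sum>v=1..n. indicator {\<Phi>. d \<le> real (var_degree \<Phi> v)} \<Phi>)"
    by simp
  also have "\<dots> = (\<Sum>v=1..n. ?E (indicator {\<Phi>. d \<le> real (var_degree \<Phi> v)}))"
    by (rule Bochner_Integration.integral_sum)
      (intro integrable_measure_pmf_finite finite_set_replicate_pmf finD)
  finally show ?thesis by simp
qed

lemma prob_num_vars_degree_ge_deviation_le:
  assumes card: "\<And>c. c \<in> set_pmf D \<Longrightarrow> card (clause_vars c) \<le> k" and t: "t > 0"
  shows "measure_pmf.prob (replicate_pmf m D)
     {\<Phi>. t \<le> \<bar>real (num_vars_degree_ge n \<Phi> d) -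
       measure_pmf.expectation (replicate_pmf m D) (\<lambda>\<Phi>. real (num_vars_degree_ge n \<Phi> d))\<bar>}
    \<le> real m * (real k)\<^sup>2 / t\<^sup>2"
proof (rule prob_replicate_pmf_deviation_le[OF finD _ t])
  fix xs x y ys
  assume "x \<in> set_pmf D" "y \<in> set_pmf D"
  then have "card (clause_vars x) \<le> k" "card (clause_vars y) \<le> k"
    using card by auto
  then show "\<bar>real (num_vars_degree_ge n (xs @ x # ys) d) -
      real (num_vars_degree_ge n (xs @ y # ys) d)\<bar> \<le> real k"
    using num_vars_degree_ge_replace_clause[of n xs x ys d y]
      num_vars_degree_ge_replace_clause[of n xs y ys d x] by linarith
qed

section \<open>Counting between surely heavy variables \<open>S\<close> and possibly heavy variables
  \<open>T\<close>\<close>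

context
  fixes n :: nat and d :: real and S T :: "nat set"
  assumes d: "1 \<le> d"
    and S: "S \<subseteq> {1..n}" "\<And>v. v \<in> S \<Longrightarrow> 4 * d \<le> real m * measure_pmf.prob D {c. v \<in> clause_vars c}"
    and T: "T \<subseteq> {1..n}"
      "\<And>v. v \<in> {1..n} - T \<Longrightarrow> real m * measure_pmf.prob D {c. v \<in> clause_vars c} \<le> d / 4"
begin

text \<open>Below, only \<open>S\<close> is counted, each member reaching degree \<open>d\<close>
  with probability at least one half. Above, \<open>T\<close> is counted in full and every other
  variable contributes at most its Chernoff error.\<close>

lemma expectation_num_vars_degree_ge_bounds:
  "measure_pmf.expectation (replicate_pmf m D) (\<lambda>\<Phi>. real (num_vars_degree_ge n \<Phi> d))
    \<in> {real (card S) / 2..real (card T) + real n * exp (- d / 2)}"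
proof -
  let ?P = "\<lambda>v. measure_pmf.prob (replicate_pmf m D) {\<Phi>. d \<le> real (var_degree \<Phi> v)}"
  have half: "1 / 2 \<le> ?P v" if v: "v \<in> S" for v
  proof -
    have "?P v = 1 - measure_pmf.prob (replicate_pmf m D) {\<Phi>. real (var_degree \<Phi> v) < d}"
      by (subst measure_pmf.prob_compl[symmetric]) (auto intro!: arg_cong2[of _ _ _ _ measure])
    \<comment> \<open>This is where \<open>1 \<le> d\<close> enters.\<close>
    moreover have "exp (- d) \<le> 1 / 2"
    proof -
      have "2 \<le> exp d" using exp_ge_add_one_self[of d] d by linarith
      then show ?thesis by (simp add: exp_minus field_simps)
    qed
    ultimately show ?thesis using prob_var_degree_less_le[OF S(2)[OF v]] by simp
  qed
  have "real (card S) / 2 \<le> (\<Sum>v\<in>S. ?P v)"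
    using sum_bounded_below[of S "1 / 2" ?P] half by simp
  also have "\<dots> \<le> (\<Sum>v=1..n. ?P v)"
    using S(1) by (intro sum_mono2) auto
  finally have 1: "real (card S) / 2 \<le> (\<Sum>v=1..n. ?P v)" .
  have "(\<Sum>v=1..n. ?P v) = (\<Sum>v\<in>T. ?P v) + (\<Sum>v\<in>{1..n} - T. ?P v)"
    using T(1) by (subst sum.subset_diff[of T]) auto
  also have "(\<Sum>v\<in>T. ?P v) \<le> (\<Sum>v\<in>T. 1)"
    by (intro sum_mono) auto
  also have "(\<Sum>v\<in>{1..n} - T. ?P v) \<le> (\<Sum>v\<in>{1..n} - T. exp (- d / 2))"
    by (intro sum_mono prob_var_degree_ge_le T(2))
  also have "\<dots> \<le> (\<Sum>v\<in>{1..n}. exp (- d / 2))"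
    by (intro sum_mono2) auto
  finally show ?thesis
    using 1 unfolding expectation_num_vars_degree_ge by simp
qed

text \<open>If no Chernoff estimate fails, the set of variables of degree at least \<open>d\<close>
  contains \<open>S\<close> and is contained in \<open>T\<close>. Each of the two kinds of failure
  concerns at most \<open>n\<close> variables.\<close>

lemma prob_num_vars_degree_ge_union_bound:
  "1 - 2 * real n * exp (- d / 2) \<le> measure_pmf.prob (replicate_pmf m D)
    {\<Phi>. real (num_vars_degree_ge n \<Phi> d) \<in> {real (card S)..real (card T)}}"
proof -
  let ?M = "replicate_pmf m D"
  have fin: "finite S" "finite T" using S(1) T(1) finite_subset by auto
  let ?A = "\<Union>v\<in>S. {\<Phi>. real (var_degree \<Phi> v) < d}"
  let ?B = "\<Union>v\<in>{1..n} - T. {\<Phi>. d \<le> real (var_degree \<Phi> v)}"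
  let ?G = "{\<Phi>. real (num_vars_degree_ge n \<Phi> d) \<in> {real (card S)..real (card T)}}"
  have "UNIV - ?G \<subseteq> ?A \<union> ?B"
  proof
    fix \<Phi> assume "\<Phi> \<in> UNIV - ?G"
    then have notG: "\<not> (card S \<le> num_vars_degree_ge n \<Phi> d \<and> num_vars_degree_ge n \<Phi> d \<le> card T)"
      by simp
    show "\<Phi> \<in> ?A \<union> ?B"
    proof (rule ccontr)
      assume "\<Phi> \<notin> ?A \<union> ?B"
      then have "S \<subseteq> {v \<in> {1..n}. d \<le> real (var_degree \<Phi> v)}"
        and "{v \<in> {1..n}. d \<le> real (var_degree \<Phi> v)} \<subseteq> T"
        using S(1) by (auto simp: not_less)
      then have "card S \<le> num_vars_degree_ge n \<Phi> d" "num_vars_degree_ge n \<Phi> d \<le> card T"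
        unfolding num_vars_degree_ge_def using fin by (auto intro!: card_mono)
      with notG show False by blast
    qed
  qed
  then have "measure_pmf.prob ?M (UNIV - ?G) \<le> measure_pmf.prob ?M (?A \<union> ?B)"
    by (intro measure_pmf.finite_measure_mono) auto
  also have "\<dots> \<le> measure_pmf.prob ?M ?A + measure_pmf.prob ?M ?B"
    by (intro measure_Un_le) auto
  also have "measure_pmf.prob ?M ?A \<le> (\<Sum>v\<in>S. measure_pmf.prob ?M {\<Phi>. real (var_degree \<Phi> v) < d})"
    using fin by (intro measure_pmf.finite_measure_subadditive_finite) auto
  also have "\<dots> \<le> (\<Sum>v\<in>S. exp (- d / 2))"
  proof (intro sum_mono)
    fix v assume v: "v \<in> S"
    have "exp (- d) \<le> exp (- d / 2)" using d by simp
    then show "measure_pmf.prob ?M {\<Phi>. real (var_degree \<Phi> v) < d} \<le> exp (- d / 2)"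
      using prob_var_degree_less_le[OF S(2)[OF v]] by linarith
  qed
  also have "\<dots> \<le> (\<Sum>v=1..n. exp (- d / 2))"
    using S(1) by (intro sum_mono2) auto
  also have "measure_pmf.prob ?M ?B \<le> (\<Sum>v\<in>{1..n} - T. measure_pmf.prob ?M {\<Phi>. d \<le> real (var_degree \<Phi> v)})"
    by (intro measure_pmf.finite_measure_subadditive_finite) auto
  also have "\<dots> \<le> (\<Sum>v\<in>{1..n} - T. exp (- d / 2))"
    by (intro sum_mono prob_var_degree_ge_le T(2))
  also have "\<dots> \<le> (\<Sum>v=1..n. exp (- d / 2))"
    by (intro sum_mono2) auto
  finally have "measure_pmf.prob ?M (UNIV - ?G) \<le> 2 * real n * exp (- d / 2)"
    by simp
  then show ?thesis
    using measure_pmf.prob_compl[of ?G ?M] by simp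
qed

end

end

section \<open>Power-law weights\<close>

text \<open>Comparison with the integral of \<open>z powr (- s)\<close>, carried out one unit
  interval at a time by the mean value theorem for \<open>z powr (1 - s)\<close>.\<close>

lemma sum_powr_neg_le:
  assumes "0 < s" "s < 1"
  shows "(\<Sum>r=1..n. real r powr (- s)) \<le> real n powr (1 - s) / (1 - s)"
proof (induction n)
  case 0
  then show ?case by simp
next
  case (Suc n)
  let ?x = "real n + 1"
  have "(1 - s) * ?x powr (- s) \<le> ?x powr (1 - s) - real n powr (1 - s)"
  proof (cases "n = 0")
    case True
    then show ?thesis using assms by simp
  next
    case False
    have der: "((\<lambda>z. z powr (1 - s)) has_real_derivative (1 - s) * z powr (- s)) (at z)"
      if "real n \<le> z" for z
      using False that by (auto intro!: derivative_eq_intros)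
    obtain z where z: "real n < z" "z < ?x"
      and eq: "?x powr (1 - s) - real n powr (1 - s) = (?x - real n) * ((1 - s) * z powr (- s))"
      using MVT2[of "real n" ?x "\<lambda>z. z powr (1 - s)", OF _ der] by auto
    have "?x powr (- s) \<le> z powr (- s)"
      using z False assms by (intro powr_mono2') auto
    then show ?thesis
      unfolding eq using assms by simp
  qed
  then have "?x powr (- s) \<le> (?x powr (1 - s) - real n powr (1 - s)) / (1 - s)"
    using assms by (simp add: le_divide_eq mult.commute)
  with Suc show ?case
    by (simp add: diff_divide_distrib add.commute)
qed

text \<open>Raise \<open>x \<le> exp x\<close> at \<open>x = d / (2 * g)\<close> to the power
  \<open>g\<close>. With \<open>g = \<beta> - 1\<close> this brings the Chernoff error to the order
  \<open>d powr (1 - \<beta>)\<close> of the power law.\<close>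

lemma exp_neg_half_le_powr:
  fixes d g :: real
  assumes "0 < d" "0 < g"
  shows "exp (- d / 2) \<le> (2 * g) powr g * d powr (- g)"
proof -
  have "d powr g = (2 * g) powr g * (d / (2 * g)) powr g"
    using assms by (subst powr_mult[symmetric]) auto
  also have "\<dots> \<le> (2 * g) powr g * exp (d / (2 * g)) powr g"
  proof (intro mult_left_mono powr_mono2)
    show "d / (2 * g) \<le> exp (d / (2 * g))"
      using exp_ge_add_one_self[of "d / (2 * g)"] by linarith
  qed (use assms in auto)
  also have "exp (d / (2 * g)) powr g = exp (d / 2)"
    using assms by (simp add: powr_def)
  finally show ?thesis
    using assms by (simp add: exp_minus powr_minus field_simps)
qed

text \<open>The \<open>n + 1 - i\<close> variables from \<open>i\<close> on have weight at least \<open>w i\<close>, so the power law bounds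
  \<open>w i\<close> by a constant times \<open>(n / (n + 1 - i)) powr (1 / (\<beta> - 1))\<close>.\<close>

lemma sum_power_law_weights_le:
  fixes w :: "nat \<Rightarrow> real" and \<beta> b :: real
  assumes \<beta>: "\<beta> > 2" and b: "b > 0"
    and pos: "\<And>i. i \<in> {1..n} \<Longrightarrow> 0 < w i" and mono: "mono_on {1..n} w"
    and tail: "\<And>x. x \<in> {w 1..w n} \<Longrightarrow>
      real (card {i \<in> {1..n}. x \<le> w i}) / real n \<le> b * x powr (1 - \<beta>)"
  shows "(\<Sum>i=1..n. w i) \<le> b powr (1 / (\<beta> - 1)) / (1 - 1 / (\<beta> - 1)) * real n"
proof -
  define s where "s = 1 / (\<beta> - 1)"
  \<comment> \<open>\<open>s < 1\<close> is equivalent to \<open>\<beta> > 2\<close> here; it makes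
    the sum of the bounds linear in \<open>n\<close>.\<close>
  have s: "0 < s" "s < 1" using \<beta> unfolding s_def by auto
  have le: "w i \<le> (b * real n) powr s * real (n + 1 - i) powr (- s)" if i: "i \<in> {1..n}" for i
  proof -
    define r where "r = real (n + 1 - i)"
    have r: "r > 0" and n: "real n > 0" using i unfolding r_def by auto
    have wi: "w i \<in> {w 1..w n}"
      using i by (auto intro!: mono_onD[OF mono])
    have "{i..n} \<subseteq> {j \<in> {1..n}. w i \<le> w j}"
      using i by (auto intro!: mono_onD[OF mono])
    then have "card {i..n} \<le> card {j \<in> {1..n}. w i \<le> w j}"
      by (intro card_mono) auto
    then have "r / real n \<le> real (card {j \<in> {1..n}. w i \<le> w j}) / real n"
      unfolding r_def by (intro divide_right_mono) auto
    also have "\<dots> \<le> b * w i powr (1 - \<beta>)" by (rule tail[OF wi])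
    also have "w i powr (1 - \<beta>) = 1 / w i powr (\<beta> - 1)"
      using powr_minus_divide[of "w i" "\<beta> - 1"] by simp
    finally have "r / real n \<le> b / w i powr (\<beta> - 1)" by simp
    moreover have "w i powr (\<beta> - 1) > 0" using pos[OF i] by simp
    ultimately have "w i powr (\<beta> - 1) \<le> b * real n / r"
      using r n by (simp add: field_simps)
    then have "(w i powr (\<beta> - 1)) powr s \<le> (b * real n / r) powr s"
      using s by (intro powr_mono2) auto
    also have "(w i powr (\<beta> - 1)) powr s = w i"
      using pos[OF i] \<beta> by (simp add: powr_powr s_def)
    also have "(b * real n / r) powr s = (b * real n) powr s * r powr (- s)"
      using b n r by (simp add: powr_divide powr_minus_divide)
    finally show ?thesis unfolding r_def .
  qed
  have "(\<Sum>i=1..n. w i) \<le> (\<Sum>i=1..n. (b * real n) powr s * real (n + 1 - i) powr (- s))"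
    by (intro sum_mono le)
  also have "\<dots> = (b * real n) powr s * (\<Sum>i=1..n. real (n + 1 - i) powr (- s))"
    by (simp add: sum_distrib_left)
  \<comment> \<open>Summing from the heaviest variable downwards, \<open>r = n + 1 - i\<close> is
    the rank of variable \<open>i\<close>.\<close>
  also have "(\<Sum>i=1..n. real (n + 1 - i) powr (- s)) = (\<Sum>r=1..n. real r powr (- s))"
    by (rule sum.reindex_bij_witness[of _ "\<lambda>r. n + 1 - r" "\<lambda>i. n + 1 - i"]) auto
  also have "(b * real n) powr s * \<dots> \<le> (b * real n) powr s * (real n powr (1 - s) / (1 - s))"
    by (intro mult_left_mono sum_powr_neg_le s) auto
  also have "\<dots> = b powr s / (1 - s) * (real n powr s * real n powr (1 - s))"
    using b by (simp add: powr_mult)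
  also have "real n powr s * real n powr (1 - s) = real n"
    by (simp flip: powr_add)
  finally show ?thesis unfolding s_def .
qed

section \<open>Concentration for a fixed number of variables, with explicit constants\<close>

lemma num_vars_degree_ge_concentration:
  fixes D :: "clause pmf" and w :: "nat \<Rightarrow> real" and \<beta> a b c A M d :: real and m n k :: nat
  defines "L \<equiv> a * (4 / c) powr (1 - \<beta>)"
    and "U \<equiv> b * (1 / (4 * A)) powr (1 - \<beta>) + (2 * (\<beta> - 1)) powr (\<beta> - 1)"
  assumes \<beta>: "\<beta> > 2" and cpos: "0 < a" "0 < b" "0 < c" "0 < A" "0 < M"
    and n: "n \<ge> 1"
    and pos: "\<And>i. i \<in> {1..n} \<Longrightarrow> 0 < w i"
    and law: "\<And>x. x \<in> {w 1..w n} \<Longrightarrow>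
      real (card {i \<in> {1..n}. x \<le> w i}) / real n \<in> {a * x powr (1 - \<beta>)..b * x powr (1 - \<beta>)}"
    and finD: "finite (set_pmf D)"
    and card: "\<And>C. C \<in> set_pmf D \<Longrightarrow> card (clause_vars C) \<le> k"
    and mean: "\<And>v. v \<in> {1..n} \<Longrightarrow>
      real m * measure_pmf.prob D {C. v \<in> clause_vars C} \<in> {c * w v..A * w v}"
    and m: "real m \<le> M * real n"
    and d: "1 \<le> d" "4 * A * w 1 \<le> d" "4 * d / c \<le> w n"
    and large: "2 * real n * exp (- (real n powr (1 / (4 * (\<beta> - 1)))) / 2) \<le> real n powr (- (1 / 2))"
  shows "1 - (16 * M * (real k)\<^sup>2 / L\<^sup>2 + 1) * real n powr (- (1 / 2))
    \<le> measure_pmf.prob (replicate_pmf m D)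
      {\<Phi>. real (num_vars_degree_ge n \<Phi> d)
        \<in> {L / 4 * (real n * d powr (1 - \<beta>))..(U + L / 4) * (real n * d powr (1 - \<beta>))}}"
    (is "_ \<le> measure_pmf.prob ?M ?G")
proof -
  \<comment> \<open>The mean degree of \<open>v\<close> lies between \<open>c * w v\<close> and
    \<open>A * w v\<close>. Weight at least \<open>4 * d / c\<close> thus forces a mean of at least
    \<open>4 * d\<close>, and weight below \<open>d / (4 * A)\<close> a mean of at most
    \<open>d / 4\<close>. \<open>L\<close> and the first summand of \<open>U\<close> are the
    power-law constants at these two thresholds.\<close>
  define S where "S = {i \<in> {1..n}. 4 * d / c \<le> w i}"
  define T where "T = {i \<in> {1..n}. d / (4 * A) \<le> w i}"
  define Z where "Z = real n * d powr (1 - \<beta>)"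
  have d0: "d > 0" using d(1) by simp
  have n0: "real n > 0" using n by simp
  have Z: "Z > 0" unfolding Z_def using n0 d0 by simp
  have L: "L > 0" unfolding L_def using cpos by simp
  \<comment> \<open>Variable 1 alone forces \<open>c \<le> A\<close>. This orders the two
    thresholds, so one lower and one upper condition on \<open>d\<close> place both in the range of
    the power law.\<close>
  have "c * w 1 \<le> A * w 1" using mean[of 1] n by auto
  then have cA: "c \<le> A" using pos[of 1] n by simp
  have "d / (4 * A) \<le> 4 * d / c"
    using cA cpos d0 by (intro frac_le) auto
  moreover have "w 1 \<le> d / (4 * A)"
    using d(2) cpos by (simp add: le_divide_eq mult_ac)
  ultimately have x: "4 * d / c \<in> {w 1..w n}" "d / (4 * A) \<in> {w 1..w n}"
    using d(3) by auto
  have "L * d powr (1 - \<beta>) = a * (4 * d / c) powr (1 - \<beta>)"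
    unfolding L_def using cpos d0 by (simp add: powr_mult powr_divide)
  then have "L * Z = a * (4 * d / c) powr (1 - \<beta>) * real n"
    unfolding Z_def by (metis mult.assoc mult.commute)
  then have cardS: "L * Z \<le> real (card S)"
    using law[OF x(1)] n0 unfolding S_def by (simp add: le_divide_eq)
  have "b * (1 / (4 * A)) powr (1 - \<beta>) * d powr (1 - \<beta>) = b * (d / (4 * A)) powr (1 - \<beta>)"
    using cpos d0 by (simp add: powr_mult powr_divide)
  then have "b * (1 / (4 * A)) powr (1 - \<beta>) * Z = b * (d / (4 * A)) powr (1 - \<beta>) * real n"
    unfolding Z_def by (metis mult.assoc mult.commute)
  moreover have "real (card T) \<le> b * (d / (4 * A)) powr (1 - \<beta>) * real n"
  proof -
    have "real (card T) / real n \<le> b * (d / (4 * A)) powr (1 - \<beta>)"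
      using law[OF x(2)] unfolding T_def by simp
    then show ?thesis using n0 by (simp only: divide_le_eq split: if_splits)
  qed
  ultimately have cardT: "real (card T) \<le> b * (1 / (4 * A)) powr (1 - \<beta>) * Z"
    by linarith
  have S: "S \<subseteq> {1..n}" "\<And>v. v \<in> S \<Longrightarrow> 4 * d \<le> real m * measure_pmf.prob D {c. v \<in> clause_vars c}"
    using mean cpos unfolding S_def by (auto simp: field_simps intro: order.trans)
  have T: "T \<subseteq> {1..n}"
      "\<And>v. v \<in> {1..n} - T \<Longrightarrow> real m * measure_pmf.prob D {c. v \<in> clause_vars c} \<le> d / 4"
  proof -
    fix v assume v: "v \<in> {1..n} - T"
    then have "w v < d / (4 * A)" unfolding T_def by auto
    then have "A * w v \<le> d / 4" using cpos by (simp add: field_simps)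
    then show "real m * measure_pmf.prob D {c. v \<in> clause_vars c} \<le> d / 4"
      using mean[of v] v by auto
  qed (auto simp: T_def)
  \<comment> \<open>The Chernoff errors of all \<open>n\<close> variables together are of order
    \<open>Z\<close>; they are the second summand of \<open>U\<close>.\<close>
  have "exp (- d / 2) \<le> (2 * (\<beta> - 1)) powr (\<beta> - 1) * d powr (1 - \<beta>)"
    using exp_neg_half_le_powr[of d "\<beta> - 1"] d0 \<beta> by simp
  then have "real n * exp (- d / 2) \<le> (2 * (\<beta> - 1)) powr (\<beta> - 1) * Z"
    unfolding Z_def using n0 by (simp add: mult.left_commute)
  with cardT have U: "real (card T) + real n * exp (- d / 2) \<le> U * Z"
    unfolding U_def by (simp add: distrib_right)
  have K: "0 \<le> 16 * M * (real k)\<^sup>2 / L\<^sup>2" using cpos by simp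
  show ?thesis
  \<comment> \<open>The cut is chosen so that below it \<open>d powr (2 * (\<beta> - 1))\<close> is
    at most the square root of \<open>n\<close>. Then \<open>n / Z\<^sup>2\<close> is at most
    \<open>n powr (- 1 / 2)\<close>, as Chebyshev's inequality requires. Above the cut,
    \<open>large\<close> controls the union bound.\<close>
  proof (cases "d \<le> real n powr (1 / (4 * (\<beta> - 1)))")
    case True
    let ?E = "measure_pmf.expectation ?M (\<lambda>\<Phi>. real (num_vars_degree_ge n \<Phi> d))"
    have "?E \<in> {real (card S) / 2..real (card T) + real n * exp (- d / 2)}"
      by (rule expectation_num_vars_degree_ge_bounds[OF finD d(1) S T])
    then have E: "L / 2 * Z \<le> ?E" "?E \<le> U * Z" using cardS U by auto
    \<comment> \<open>The expectation is at least \<open>L / 2 * Z\<close>, so a deviation below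
      \<open>L / 4 * Z\<close> leaves \<open>L / 4 * Z\<close> and adds at most that much
      above.\<close>
    have sub: "UNIV - {\<Phi>. L / 4 * Z \<le> \<bar>real (num_vars_degree_ge n \<Phi> d) - ?E\<bar>} \<subseteq> ?G"
    proof
      fix \<Phi> assume "\<Phi> \<in> UNIV - {\<Phi>. L / 4 * Z \<le> \<bar>real (num_vars_degree_ge n \<Phi> d) - ?E\<bar>}"
      then have "\<bar>real (num_vars_degree_ge n \<Phi> d) - ?E\<bar> < L / 4 * Z" by simp
      moreover have "(U + L / 4) * Z = U * Z + L / 4 * Z" "L / 2 * Z = L / 4 * Z + L / 4 * Z"
        by (simp_all add: algebra_simps)
      ultimately have "L / 4 * Z \<le> real (num_vars_degree_ge n \<Phi> d)"
        "real (num_vars_degree_ge n \<Phi> d) \<le> (U + L / 4) * Z"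
        using E by linarith+
      then show "\<Phi> \<in> ?G" unfolding Z_def by simp
    qed
    have "d powr (2 * (\<beta> - 1)) \<le> (real n powr (1 / (4 * (\<beta> - 1)))) powr (2 * (\<beta> - 1))"
      using True d0 \<beta> by (intro powr_mono2) auto
    also have "\<dots> = real n powr (1 / (4 * (\<beta> - 1)) * (2 * (\<beta> - 1)))"
      by (rule powr_powr)
    also have "1 / (4 * (\<beta> - 1)) * (2 * (\<beta> - 1)) = 1 / 2"
      using \<beta> by (simp add: divide_simps)
    finally have dn: "d powr (2 * (\<beta> - 1)) \<le> real n powr (1 / 2)" .
    have "measure_pmf.prob ?M {\<Phi>. L / 4 * Z \<le> \<bar>real (num_vars_degree_ge n \<Phi> d) - ?E\<bar>}
        \<le> real m * (real k)\<^sup>2 / (L / 4 * Z)\<^sup>2"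
      using L Z by (intro prob_num_vars_degree_ge_deviation_le finD card) auto
    also have "\<dots> \<le> (M * real n) * (real k)\<^sup>2 / (L / 4 * Z)\<^sup>2"
      using m by (intro divide_right_mono mult_right_mono) auto
    also have "\<dots> = 16 * M * (real k)\<^sup>2 / L\<^sup>2 * (real n powr (- 1) * d powr (2 * (\<beta> - 1)))"
    proof -
      have "(d powr (1 - \<beta>))\<^sup>2 = d powr (- (2 * (\<beta> - 1)))"
        by (simp add: power2_eq_square flip: powr_add)
      also have "\<dots> = 1 / d powr (2 * (\<beta> - 1))"
        by (rule powr_minus_divide)
      finally have "(L / 4 * Z)\<^sup>2 = L\<^sup>2 / 16 * ((real n)\<^sup>2 / d powr (2 * (\<beta> - 1)))"
        unfolding Z_def by (simp add: power_mult_distrib power_divide)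
      moreover have "real n powr (- 1) = 1 / real n"
        using n0 by (simp add: powr_minus_divide)
      moreover have "M * N * K / (l / 16 * (N\<^sup>2 / x)) = 16 * M * K / l * (1 / N * x)"
        if "N > 0" "l > 0" "x > 0" for N K l x :: real
        using that by (simp add: field_simps power2_eq_square)
      ultimately show ?thesis using n0 d0 L by simp
    qed
    also have "\<dots> \<le> 16 * M * (real k)\<^sup>2 / L\<^sup>2 * (real n powr (- 1) * real n powr (1 / 2))"
      using dn K by (intro mult_left_mono) auto
    also have "real n powr (- 1) * real n powr (1 / 2) = real n powr (- (1 / 2))"
      by (subst powr_add[symmetric]) simp
    also have "16 * M * (real k)\<^sup>2 / L\<^sup>2 * \<dots> \<le> (16 * M * (real k)\<^sup>2 / L\<^sup>2 + 1) * real n powr (- (1 / 2))"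
      by (intro mult_right_mono) auto
    finally have "1 - (16 * M * (real k)\<^sup>2 / L\<^sup>2 + 1) * real n powr (- (1 / 2))
        \<le> measure_pmf.prob ?M (UNIV - {\<Phi>. L / 4 * Z \<le> \<bar>real (num_vars_degree_ge n \<Phi> d) - ?E\<bar>})"
      using measure_pmf.prob_compl[of "{\<Phi>. L / 4 * Z \<le> \<bar>real (num_vars_degree_ge n \<Phi> d) - ?E\<bar>}" ?M]
      by simp
    also have "\<dots> \<le> measure_pmf.prob ?M ?G"
      using sub by (intro measure_pmf.finite_measure_mono) auto
    finally show ?thesis .
  next
    case False
    have "exp (- d / 2) \<le> exp (- (real n powr (1 / (4 * (\<beta> - 1)))) / 2)"
      using False by simp
    then have "2 * real n * exp (- d / 2) \<le> 2 * real n * exp (- (real n powr (1 / (4 * (\<beta> - 1)))) / 2)"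
      using n0 by (intro mult_left_mono) auto
    also have "\<dots> \<le> 1 * real n powr (- (1 / 2))"
      using large by simp
    also have "\<dots> \<le> (16 * M * (real k)\<^sup>2 / L\<^sup>2 + 1) * real n powr (- (1 / 2))"
      using K by (intro mult_right_mono) auto
    finally have "1 - (16 * M * (real k)\<^sup>2 / L\<^sup>2 + 1) * real n powr (- (1 / 2))
        \<le> 1 - 2 * real n * exp (- d / 2)" by simp
    also have "\<dots> \<le> measure_pmf.prob ?M
        {\<Phi>. real (num_vars_degree_ge n \<Phi> d) \<in> {real (card S)..real (card T)}}"
      by (rule prob_num_vars_degree_ge_union_bound[OF finD d(1) S T])
    also have "\<dots> \<le> measure_pmf.prob ?M ?G"
    proof -
      have "L / 4 * Z \<le> L * Z" "U * Z \<le> (U + L / 4) * Z"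
        using L Z by (auto intro!: mult_right_mono)
      moreover have "real (card T) \<le> U * Z"
        using U mult_nonneg_nonneg[OF of_nat_0_le_iff exp_ge_zero, of n "- d / 2"] by linarith
      ultimately have "L / 4 * Z \<le> real (card S)" "real (card T) \<le> (U + L / 4) * Z"
        using cardS by linarith+
      then show ?thesis
        unfolding Z_def[symmetric] by (intro measure_pmf.finite_measure_mono) auto
    qed
    finally show ?thesis .
  qed
qed

section \<open>From explicit bounds to asymptotics\<close>

lemma eventually_exp_neg_powr_le:
  fixes e :: real
  assumes "e > 0"
  shows "\<forall>\<^sub>F n in sequentially. 2 * real n * exp (- (real n powr e) / 2) \<le> real n powr (- (1 / 2))"
  using assms by real_asymp

theorem theorem7:
  fixes k :: nat and \<beta> :: real and m :: "nat \<Rightarrow> nat" and w :: "nat \<Rightarrow> nat \<Rightarrow> real"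
  assumes "k \<ge> 2"
    and "\<beta> > 2"
    and "(\<lambda>n. real (m n)) \<in> \<Theta>(\<lambda>n. real n)"
    and "\<And>n i. i \<in> {1..n} \<Longrightarrow> 0 < w n i"
    and "\<And>n. mono_on {1..n} (w n)"
    and "power_law_weights \<beta> w"
  shows "\<exists>dmin dmax :: nat \<Rightarrow> real.
    (\<forall>n. 0 < dmin n) \<and> (\<forall>n. 0 < dmax n) \<and>
    dmin \<in> \<Theta>(\<lambda>n. w n 1) \<and> dmax \<in> \<Theta>(\<lambda>n. w n n) \<and>
    (\<exists>a>0. \<exists>b>0. \<exists>C>0. \<exists>\<delta>>0. \<forall>\<^sub>F n in sequentially. \<forall>d\<in>{dmin n..dmax n}.
      measure_pmf.prob (random_ksat k (m n) (weight_pmf n (w n)))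
        {\<Phi>. real (num_vars_degree_ge n \<Phi> d)
              \<in> {a * (real n * d powr (1 - \<beta>))..b * (real n * d powr (1 - \<beta>))}}
      \<ge> 1 - C * real n powr (- \<delta>))"
proof -
  define s where "s = 1 / (\<beta> - 1)"
  have s: "0 < s" "s < 1" using assms(2) unfolding s_def by auto
  note pos = assms(4) and mono = assms(5)
  have w1: "(\<lambda>n. w n 1) \<in> \<Theta>(\<lambda>n. 1)" and wn: "(\<lambda>n. w n n) \<in> \<Theta>(\<lambda>n. real n powr s)"
    using assms(6) unfolding power_law_weights_def s_def by auto
  obtain a b where ab: "0 < a" "0 < b" and law: "\<forall>\<^sub>F n in sequentially. \<forall>x\<in>{w n 1..w n n}.
        real (card {i \<in> {1..n}. x \<le> w n i}) / real n
          \<in> {a * x powr (1 - \<beta>)..b * x powr (1 - \<beta>)}"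
    using assms(6) unfolding power_law_weights_def by blast
  obtain b1 where b1: "b1 > 0" "\<forall>\<^sub>F n in sequentially. norm (w n 1) \<le> b1 * norm (1::real)"
    using landau_o.bigE[OF bigthetaD1[OF w1]] by blast
  obtain a1 where a1: "a1 > 0" "\<forall>\<^sub>F n in sequentially. norm (w n 1) \<ge> a1 * norm (1::real)"
    using landau_omega.bigE[OF bigthetaD2[OF w1]] by blast
  obtain b2 where b2: "b2 > 0" "\<forall>\<^sub>F n in sequentially. norm (w n n) \<le> b2 * norm (real n powr s)"
    using landau_o.bigE[OF bigthetaD1[OF wn]] by blast
  obtain b3 where b3: "b3 > 0" "\<forall>\<^sub>F n in sequentially. norm (real (m n)) \<le> b3 * norm (real n)"
    using landau_o.bigE[OF bigthetaD1[OF assms(3)]] by blast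
  obtain a3 where a3: "a3 > 0" "\<forall>\<^sub>F n in sequentially. norm (real (m n)) \<ge> a3 * norm (real n)"
    using landau_omega.bigE[OF bigthetaD2[OF assms(3)]] by blast
  \<comment> \<open>The total weight lies between \<open>a1 * n\<close> and \<open>B * n\<close>,
    the number of clauses between \<open>a3 * n\<close> and \<open>b3 * n\<close>, and a clause
    contains a variable of probability \<open>q\<close> with probability between
    \<open>q / 2\<close> and \<open>2 * k * q\<close>. Multiplying these out gives \<open>c\<close>
    and \<open>A\<close>.\<close>
  define B where "B = b powr s / (1 - s)"
  define A where "A = 2 * real k * b3 / a1"
  define c where "c = a3 / (2 * B)"
  have B: "B > 0" unfolding B_def using ab s by simp
  have A: "A > 0" unfolding A_def using assms(1) a1 b3 by simp
  have c: "c > 0" unfolding c_def using a3 B by simp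
  define L where "L = a * (4 / c) powr (1 - \<beta>)"
  define U where "U = b * (1 / (4 * A)) powr (1 - \<beta>) + (2 * (\<beta> - 1)) powr (\<beta> - 1)"
  define C where "C = 16 * b3 * (real k)\<^sup>2 / L\<^sup>2 + 1"
  have L: "L > 0" unfolding L_def using ab c by simp
  have U: "U > 0" unfolding U_def using ab A assms(2) by (intro add_pos_pos) auto
  have C: "C > 0" unfolding C_def using b3 by (intro add_nonneg_pos) auto
  \<comment> \<open>A constant suffices for \<open>dmin\<close>, as \<open>w n 1\<close> is
    eventually at most \<open>b1\<close>; it ensures both \<open>1 \<le> d\<close> and
    \<open>4 * A * w n 1 \<le> d\<close>. The factor in \<open>dmax\<close> gives
    \<open>4 * d / c \<le> w n n\<close>. The value 1 at \<open>n = 0\<close> secures positivity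
    where no weight is constrained.\<close>
  define dmin where "dmin = (\<lambda>n::nat. 4 * A * b1 + 1)"
  define dmax where "dmax = (\<lambda>n. if n = 0 then 1 else c / 4 * w n n)"
  \<comment> \<open>No variable has probability above \<open>b2 / a1 * n powr (s - 1)\<close>, which
    tends to 0 because \<open>s < 1\<close>. This eventually supplies the assumption
    \<open>kr\<close> on clauses.\<close>
  have small: "\<forall>\<^sub>F n in sequentially. 2 * (real k)\<^sup>2 * (b2 / a1 * real n powr (s - 1)) \<le> 1"
  proof -
    have "((\<lambda>n. 2 * (real k)\<^sup>2 * (b2 / a1 * real n powr (s - 1))) \<longlongrightarrow>
        2 * (real k)\<^sup>2 * (b2 / a1 * 0)) sequentially"
      using s by (intro tendsto_intros tendsto_neg_powr filterlim_real_sequentially) auto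
    then show ?thesis
      by (intro order_tendstoD(2)[THEN eventually_mono]) (auto intro: less_imp_le)
  qed
  have large: "\<forall>\<^sub>F n in sequentially.
      2 * real n * exp (- (real n powr (1 / (4 * (\<beta> - 1)))) / 2) \<le> real n powr (- (1 / 2))"
    using assms(2) by (intro eventually_exp_neg_powr_le) simp
  have "\<forall>\<^sub>F n in sequentially. \<forall>d\<in>{dmin n..dmax n}.
      measure_pmf.prob (random_ksat k (m n) (weight_pmf n (w n)))
        {\<Phi>. real (num_vars_degree_ge n \<Phi> d)
              \<in> {L / 4 * (real n * d powr (1 - \<beta>))..(U + L / 4) * (real n * d powr (1 - \<beta>))}}
      \<ge> 1 - C * real n powr (- (1 / 2))"
    using law b1(2) a1(2) b2(2) b3(2) a3(2) small large eventually_ge_at_top[of 1]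
  proof eventually_elim
    case (elim n)
    note n = \<open>1 \<le> n\<close>
    let ?p = "weight_pmf n (w n)" and ?W = "\<Sum>j=1..n. w n j"
    let ?D = "random_clause k ?p"
    define r where "r = b2 / a1 * real n powr (s - 1)"
    have n0: "real n > 0" using n by simp
    have w1: "a1 \<le> w n 1" "w n 1 \<le> b1" using elim pos[of 1 n] n by auto
    have wn: "w n n \<le> b2 * real n powr s" using elim pos[of n n] n by auto
    have m: "a3 * real n \<le> real (m n)" "real (m n) \<le> b3 * real n" using elim by auto
    have "(\<Sum>j=1..n. a1) \<le> ?W"
    proof (intro sum_mono)
      fix j assume "j \<in> {1..n}"
      then have "w n 1 \<le> w n j" by (intro mono_onD[OF mono]) auto
      with w1 show "a1 \<le> w n j" by simp
    qed
    then have W1: "a1 * real n \<le> ?W" by (simp add: mult.commute)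
    have W2: "?W \<le> B * real n"
      unfolding B_def s_def
      by (rule sum_power_law_weights_le[OF assms(2) ab(2) pos mono]) (use elim(1) in auto)
    have W0: "?W > 0" using W1 a1(1) n0 by (meson less_le_trans mult_pos_pos)
    have pmf: "pmf ?p v = (if v \<in> {1..n} then w n v / ?W else 0)" for v
      by (rule pmf_weight_pmf[OF n pos])
    have fin: "finite (set_pmf ?p)"
      by (rule finite_subset[of _ "{1..n}"]) (auto simp: set_pmf_eq pmf)
    have r0: "r \<ge> 0" unfolding r_def using a1 b2 by simp
    have r: "pmf ?p v \<le> r" for v
    proof (cases "v \<in> {1..n}")
      case True
      then have "w n v \<le> w n n" by (intro mono_onD[OF mono]) auto
      then have "w n v / ?W \<le> b2 * real n powr s / (a1 * real n)"
        using wn W1 a1 n0 b2 pos[OF True] by (intro frac_le) auto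
      also have "\<dots> = r"
        unfolding r_def using n0 by (simp add: powr_diff)
      finally show ?thesis using True pmf by simp
    qed (use pmf r0 in auto)
    have k: "k \<ge> 1" using assms(1) by simp
    have kr: "2 * (real k)\<^sup>2 * r \<le> 1" unfolding r_def using elim by simp
    have mean: "real (m n) * measure_pmf.prob ?D {C. v \<in> clause_vars C} \<in> {c * w n v..A * w n v}"
      if v: "v \<in> {1..n}" for v
    proof -
      let ?q = "measure_pmf.prob ?D {C. v \<in> clause_vars C}"
      have q: "w n v / ?W / 2 \<le> ?q" "?q \<le> 2 * real k * (w n v / ?W)"
        using prob_random_clause_member[OF fin r k kr, of v] pmf[of v] v by auto
      have "c * w n v = (a3 * real n) * (w n v / (B * real n) / 2)"
        unfolding c_def using n0 by simp
      also have "\<dots> \<le> real (m n) * (w n v / ?W / 2)"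
        using m W0 W2 pos[OF v] a3 B n0
        by (intro mult_mono divide_right_mono divide_left_mono) auto
      also have "\<dots> \<le> real (m n) * ?q"
        using q by (intro mult_left_mono) auto
      finally have 1: "c * w n v \<le> real (m n) * ?q" .
      have "real (m n) * ?q \<le> real (m n) * (2 * real k * (w n v / ?W))"
        using q by (intro mult_left_mono) auto
      also have "\<dots> \<le> (b3 * real n) * (2 * real k * (w n v / (a1 * real n)))"
        using m W0 W1 pos[OF v] a1 b3 n0
        by (intro mult_mono divide_left_mono) auto
      also have "\<dots> = A * w n v"
        unfolding A_def using n0 by simp
      finally show ?thesis using 1 by simp
    qed
    show ?case
    proof
      fix d assume d: "d \<in> {dmin n..dmax n}"
      have "0 \<le> A * b1" using A b1 by simp
      then have d1: "1 \<le> d" using d unfolding dmin_def by simp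
      have "A * w n 1 \<le> A * b1" using w1 A by (intro mult_left_mono) auto
      then have d2: "4 * A * w n 1 \<le> d" using d unfolding dmin_def by simp
      have d3: "4 * d / c \<le> w n n" using d n c unfolding dmax_def by (simp add: field_simps)
      show "1 - C * real n powr (- (1 / 2)) \<le>
        measure_pmf.prob (random_ksat k (m n) (weight_pmf n (w n)))
        {\<Phi>. real (num_vars_degree_ge n \<Phi> d)
              \<in> {L / 4 * (real n * d powr (1 - \<beta>))..(U + L / 4) * (real n * d powr (1 - \<beta>))}}"
        unfolding random_ksat_def C_def L_def U_def
        by (rule num_vars_degree_ge_concentration[OF assms(2) ab c A b3(1) n pos _
              finite_set_random_clause[OF fin r k kr] card_clause_vars_random_clause[OF fin r k kr]
              mean m(2) d1 d2 d3])
          (use elim in auto)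
    qed
  qed
  moreover have "\<forall>n. 0 < dmin n"
    unfolding dmin_def using A b1 by (auto intro: add_pos_pos)
  moreover have "\<forall>n. 0 < dmax n"
    unfolding dmax_def using c pos by auto
  moreover have "dmin \<in> \<Theta>(\<lambda>n. w n 1)"
  proof -
    \<comment> \<open>A positive constant has the order of the smallest weight, which is itself of
      order 1.\<close>
    have "dmin \<in> \<Theta>(\<lambda>n. 1)"
    proof -
      have "4 * A * b1 + 1 > 0" using A b1 by (intro add_pos_pos) auto
      then show ?thesis unfolding dmin_def by simp
    qed
    also have "(\<lambda>n. 1) \<in> \<Theta>(\<lambda>n. w n 1)"
      using w1 by (simp add: bigtheta_sym)
    finally show ?thesis .
  qed
  moreover have "dmax \<in> \<Theta>(\<lambda>n. w n n)"
  proof -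
    have "\<forall>\<^sub>F n in sequentially. dmax n = c / 4 * w n n"
      using eventually_gt_at_top[of 0] by eventually_elim (simp add: dmax_def)
    then have "dmax \<in> \<Theta>(\<lambda>n. c / 4 * w n n)"
      by (rule bigthetaI_cong)
    then show ?thesis using c by simp
  qed
  moreover have "0 < L / 4" "0 < U + L / 4" using L U by auto
  ultimately show ?thesis
    \<comment> \<open>The witness for \<open>\<delta>\<close> is one half.\<close>
    using C half_gt_zero[OF zero_less_one] by blast
qed

end
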